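(* Let $X$ be a real Banach space. Suppose that $h:X\times X^*\to[-\infty,\infty]$ is proper, convex, lower semicontinuous and $$h(x,x^* )\ge\langle x,x^*\rangle\quad\forall (x,x^* )\in X\times X^*,\qquad h^*(x^*,x^{**})\ge\langle x^*,x^{**}\rangle\quad\forall (x^*,x^{**})\in X^*\times X^{**}.$$ Define $T=\{(x,x^* )\in X\times X^* \mid h(x,x^* )=\langle x,x^*\rangle\}$. Then: 1. $T=\{(x,x^* )\in X\times X^*\mid h^*(x^*,x)=\langle x,x^*\rangle\}$. 2. $T$ is maximal monotone. 3. Let $\varphi_T$ be the Fitzpatrick function associated with $T$, i.e. $\varphi_T(x,x^* )=\sup_{(y,y^* )\in T}\ \langle x,y^*\rangle+\langle y,x^*\rangle-\langle y,y^*\rangle$ for $(x,x^* )\in X\times X^*$. Then $\varphi_T(x,x^* )\ge\langle x,x^*\rangle$ for all $(x,x^* )\in X\times X^*$, and $\varphi_T^*(x^*,x^{**})\ge\langle x^*,x^{**}\rangle$ for all $(x^*,x^{**})\in X^*\times X^{**}$. 4. $T$ satisfies the strict Brønsted-Rockafellar property: if $\eta>\varepsilon$ are real numbers and $(x,x^* )\in X\times X^*$ satisfies $\langle x-y,x^*-y^*\rangle\ge-\varepsilon$ for all $(y,y^* )\in T$ (that is, $x^*\in T^\varepsilon(x)$), then for any $\lambda>0$ there exists $(\bar x_\lambda,\bar x_\lambda^* )\in X\times X^*$ such that $$\bar x_\lambda^*\in T(\bar x_\lambda),\qquad \|x-\bar x_\lambda\|<\lambda,\qquad \|x^*-\bar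 x_\lambda^*\|<\frac{\eta}{\lambda}.$$
   Context: $X^*$ and $X^{**}$ are the topological dual and bidual of $X$; all norms are denoted $\|\cdot\|$. Duality products: $\langle x,x^*\rangle=x^*(x)$ for $x\in X$, $x^*\in X^*$, and $\langle x^*,x^{**}\rangle=x^{**}(x^* )$ for $x^*\in X^*$, $x^{**}\in X^{**}$. $X$ is not assumed reflexive. A convex function $h$ is proper if $h>-\infty$ everywhere and $h$ is finite at some point. For $h:X\times X^*\to[-\infty,\infty]$, the Fenchel-Legendre conjugate $h^*:X^*\times X^{**}\to[-\infty,\infty]$ is $$h^*(x^*,x^{**})=\sup_{(y,y^* )\in X\times X^*}\ \langle y,x^*\rangle+\langle y^*,x^{**}\rangle-h(y,y^* ),$$ the dual of $X\times X^*$ being identified with $X^*\times X^{**}$. In the expression $h^*(x^*,x)$ with $x\in X$, $x$ is identified with its image under the canonical injection $X\to X^{**}$. A point-to-set operator $T:X\rightrightarrows X^*$ is a subset $T\subset X\times X^*$, and $x^*\in T(x)$ means $(x,x^* )\in T$. $T$ is monotone if $\langle x-y,x^*-y^*\rangle\ge0$ for all $(x,x^* ),(y,y^* )\in T$, and maximal monotone if it is monotone and maximal with respect to inclusion among monotone subsets of $X\times X^*$. *)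

theory Defs
  imports "HOL-Analysis.Analysis"
begin

text \<open>
  The dual of \<open>X\<close> is \<open>X \<Rightarrow>\<^sub>L real\<close> with the operator norm, and the bidual is the dual of that.
\<close>

type_synonym 'a dual = "'a \<Rightarrow>\<^sub>L real"
type_synonym 'a bidual = "('a \<Rightarrow>\<^sub>L real) \<Rightarrow>\<^sub>L real"

text \<open>
  The duality product, for \<open>X\<close> and its dual as well as for the dual and the bidual.
\<close>

abbreviation pairing :: "'a::real_normed_vector \<Rightarrow> 'a dual \<Rightarrow> real"  (\<open>(\<open>open_block notation=\<open>mixfix pairing\<close>\<close>\<langle>_,/ _\<rangle>)\<close>)
  where "\<langle>x, f\<rangle> \<equiv> blinfun_apply f x"

definition canonical_injection :: "'a::real_normed_vector \<Rightarrow> 'a bidual"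
  where "canonical_injection = blinfun.prod_left"

lemma pairing_canonical_injection [simp]: "\<langle>f, canonical_injection x\<rangle> = \<langle>x, f\<rangle>"
  by (simp add: canonical_injection_def)

definition proper :: "('a \<Rightarrow> ereal) \<Rightarrow> bool"
  where "proper h \<longleftrightarrow> (\<forall>z. h z > -\<infinity>) \<and> (\<exists>z. \<bar>h z\<bar> \<noteq> \<infinity>)"

text \<open>
  Convexity of the epigraph avoids the convention for \<open>\<infinity> - \<infinity>\<close> that
  the usual convexity inequality needs for functions with values in \<open>[-\<infinity>, \<infinity>]\<close>.
\<close>

definition convex_ereal :: "('a::real_vector \<Rightarrow> ereal) \<Rightarrow> bool"
  where "convex_ereal h \<longleftrightarrow> convex {(z, r::real). h z \<le> ereal r}"

definition lower_semicontinuous :: "('a::topological_space \<Rightarrow> ereal) \<Rightarrow> bool"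
  where "lower_semicontinuous h \<longleftrightarrow> (\<forall>z. h z \<le> Liminf (at z) h)"

text \<open>
  The first two summands are real, so the subtraction of \<open>h (y, y')\<close> never meets \<open>\<infinity> - \<infinity>\<close>.
\<close>

definition conjugate ::
    "('a::real_normed_vector \<times> 'a dual \<Rightarrow> ereal) \<Rightarrow> 'a dual \<times> 'a bidual \<Rightarrow> ereal"
  where "conjugate h = (\<lambda>(x', x''). SUP (y, y') \<in> UNIV. ereal (\<langle>y, x'\<rangle> + \<langle>y', x''\<rangle>) - h (y, y'))"

definition monotone_operator :: "('a::real_normed_vector \<times> 'a dual) set \<Rightarrow> bool"
  where "monotone_operator T \<longleftrightarrow> (\<forall>(x, x') \<in> T. \<forall>(y, y') \<in> T. \<langle>x - y, x' - y'\<rangle> \<ge> 0)"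

definition maximal_monotone :: "('a::real_normed_vector \<times> 'a dual) set \<Rightarrow> bool"
  where "maximal_monotone T \<longleftrightarrow>
    monotone_operator T \<and> (\<forall>S. monotone_operator S \<longrightarrow> T \<subseteq> S \<longrightarrow> S = T)"

definition fitzpatrick :: "('a::real_normed_vector \<times> 'a dual) set \<Rightarrow> 'a \<times> 'a dual \<Rightarrow> ereal"
  where "fitzpatrick T = (\<lambda>(x, x'). SUP (y, y') \<in> T. ereal (\<langle>x, y'\<rangle> + \<langle>y, x'\<rangle> - \<langle>y, y'\<rangle>))"

text \<open>
  This is \<open>T\<^sup>\<epsilon>\<close>; \<open>\<epsilon>\<close> may be any real number.
\<close>

definition enlargement ::
    "real \<Rightarrow> ('a::real_normed_vector \<times> 'a dual) set \<Rightarrow> ('a \<times> 'a dual) set"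
  where "enlargement \<epsilon> T = {(x, x'). \<forall>(y, y') \<in> T. \<langle>x - y, x' - y'\<rangle> \<ge> - \<epsilon>}"

definition strict_bronsted_rockafellar :: "('a::real_normed_vector \<times> 'a dual) set \<Rightarrow> bool"
  where "strict_bronsted_rockafellar T \<longleftrightarrow>
    (\<forall>\<epsilon> \<eta> x x'. \<epsilon> < \<eta> \<longrightarrow> (x, x') \<in> enlargement \<epsilon> T \<longrightarrow>
      (\<forall>r>0. \<exists>(y, y') \<in> T. norm (x - y) < r \<and> norm (x' - y') < \<eta> / r))"

end

theory Submission
  imports Defs
begin

text \<open>
  Fix a point \<open>(a, a*)\<close> and let \<open>k\<close> be \<open>h\<close> translated so that \<open>(a, a*)\<close> becomes the origin. If
  \<open>k (x, x*) + |x|^2 / 2 + |x*|^2 / 2\<close> had a positive lower bound, Hahn-Banach would give an affine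
  continuous function between \<open>k\<close> and the concave rest, which the hypothesis on the conjugate of \<open>h\<close>
  excludes. So the infimum is \<open>0\<close>, and near-minimizers are points at which \<open>h\<close> is arbitrarily close
  to the duality product; convexity bounds their distance from \<open>(a, a*)\<close> by roughly the square root
  of the gap between \<open>h\<close> and the duality product at \<open>(a, a*)\<close>. Iterating with geometrically decreasing
  gaps gives a Cauchy sequence, whose limit lies in \<open>T\<close> by lower semicontinuity. Maximality follows,
  hence the Fitzpatrick function of \<open>T\<close> satisfies the same hypotheses as \<open>h\<close>. On the
  \<open>\<epsilon>\<close>-enlargement of \<open>T\<close> its gap is at most \<open>\<epsilon>\<close>, so the same iteration applied to it yields the strict
  Bronsted-Rockafellar property.
\<close>

section \<open>The Hahn-Banach theorem\<close>

definition sublinear :: "('a::real_vector \<Rightarrow> real) \<Rightarrow> bool"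
  where "sublinear p \<longleftrightarrow>
    (\<forall>x y. p (x + y) \<le> p x + p y) \<and> (\<forall>t>0. \<forall>x. p (t *\<^sub>R x) = t * p x)"

text \<open>The inequality at \<open>1 / t\<close> and \<open>t *\<^sub>R x\<close> is the reverse
  of the one at \<open>t\<close> and \<open>x\<close>, so one direction of homogeneity
  suffices.\<close>

lemma sublinearI:
  assumes "\<And>x y. p (x + y) \<le> p x + p y"
    and "\<And>t x. t > 0 \<Longrightarrow> p (t *\<^sub>R x) \<le> t * p x"
  shows "sublinear p"
proof -
  have "t * p x \<le> p (t *\<^sub>R x)" if "t > 0" for t x
    using assms(2)[of "1 / t" "t *\<^sub>R x"] that by (simp add: field_simps)
  then show ?thesis
    using assms unfolding sublinear_def by (meson antisym)
qed

lemma sublinear_add: "sublinear p \<Longrightarrow> p (x + y) \<le> p x + p y"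
  by (simp add: sublinear_def)

lemma sublinear_scaleR: "sublinear p \<Longrightarrow> t > 0 \<Longrightarrow> p (t *\<^sub>R x) = t * p x"
  by (simp add: sublinear_def)

lemma sublinear_zero: "sublinear p \<Longrightarrow> p 0 = 0"
  using sublinear_scaleR[of p 2 0] by simp

lemma sublinear_ge_minus: "sublinear p \<Longrightarrow> - p (- x) \<le> p x"
  using sublinear_add[of p x "- x"] sublinear_zero[of p] by simp

lemma le_cINF_add:
  fixes c :: real
  assumes "A \<noteq> {}" "B \<noteq> {}" and "\<And>a b. a \<in> A \<Longrightarrow> b \<in> B \<Longrightarrow> c \<le> f a + g b"
  shows "c \<le> (INF a\<in>A. f a) + (INF b\<in>B. g b)"
proof -
  have "c - f a \<le> (INF b\<in>B. g b)" if "a \<in> A" for a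
    using assms(2,3) that by (intro cINF_greatest) (auto simp: algebra_simps)
  then have "c - (INF b\<in>B. g b) \<le> (INF a\<in>A. f a)"
    using assms(1) by (intro cINF_greatest) (auto simp: algebra_simps)
  then show ?thesis by simp
qed

lemma le_mult_cINF:
  fixes c t :: real
  assumes "A \<noteq> {}" "t > 0" and "\<And>a. a \<in> A \<Longrightarrow> c \<le> t * f a"
  shows "c \<le> t * (INF a\<in>A. f a)"
proof -
  have "c / t \<le> (INF a\<in>A. f a)"
    using assms by (intro cINF_greatest) (auto simp: field_simps)
  then show ?thesis using assms(2) by (simp add: field_simps)
qed

text \<open>
  Minimality is tested against the sublinear minorants
  \<open>x \<mapsto> inf {q (x + t v) - t q v | t \<ge> 0}\<close>.
\<close>

lemma minimal_sublinear_imp_linear: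
  assumes q: "sublinear q" and min: "\<And>q'. sublinear q' \<Longrightarrow> (\<And>x. q' x \<le> q x) \<Longrightarrow> q' = q"
  shows "linear q"
proof -
  have superadd: "q x + q v \<le> q (x + v)" for x v
  proof -
    define f where "f x t = q (x + t *\<^sub>R v) - t * q v" for x t
    define q' where "q' x = (INF t\<in>{0..}. f x t)" for x
    \<comment> \<open>The bound does not depend on \<open>t\<close>, so the infimum
      \<open>q'\<close> is taken over a set bounded below.\<close>
    have lower: "- q (- x) \<le> f x t" if "t \<ge> 0" for x t
    proof (cases "t = 0")
      case True
      then show ?thesis using sublinear_ge_minus[OF q, of x] by (simp add: f_def)
    next
      case False
      then have "t * q v = q (t *\<^sub>R v)" using that sublinear_scaleR[OF q] by simp
      also have "\<dots> \<le> q (x + t *\<^sub>R v) + q (- x)"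
        using sublinear_add[OF q, of "x + t *\<^sub>R v" "- x"] by simp
      finally show ?thesis by (simp add: f_def)
    qed
    have q'_le: "q' x \<le> f x t" if "t \<ge> 0" for x t
      unfolding q'_def using lower that by (intro cINF_lower bdd_belowI2[where m = "- q (- x)"]) auto
    have "sublinear q'"
    proof (rule sublinearI)
      fix x y
      have "q' (x + y) \<le> f x s + f y t" if "s \<ge> 0" "t \<ge> 0" for s t
      proof -
        have "q' (x + y) \<le> f (x + y) (s + t)" using that by (intro q'_le) auto
        also have "\<dots> \<le> f x s + f y t"
          using sublinear_add[OF q, of "x + s *\<^sub>R v" "y + t *\<^sub>R v"]
          by (simp add: f_def algebra_simps)
        finally show ?thesis .
      qed
      then show "q' (x + y) \<le> q' x + q' y"
        unfolding q'_def[of x] q'_def[of y] by (intro le_cINF_add) auto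
    next
      fix t :: real and x assume t: "t > 0"
      have "q' (t *\<^sub>R x) \<le> t * f x s" if "s \<ge> 0" for s
        using q'_le[of "t * s" "t *\<^sub>R x"] sublinear_scaleR[OF q t, of "x + s *\<^sub>R v"] that t
        by (simp add: f_def algebra_simps)
      then show "q' (t *\<^sub>R x) \<le> t * q' x"
        unfolding q'_def[of x] using t by (intro le_mult_cINF) auto
    qed
    moreover have "q' x \<le> q x" for x
      using q'_le[of 0 x] by (simp add: f_def)
    ultimately have "q' = q" by (rule min)
    \<comment> \<open>At parameter 1, minimality turns \<open>q' x \<le> f x 1\<close> into
      \<open>q x \<le> q (x + v) - q v\<close>.\<close>
    with q'_le[of 1 x] show ?thesis by (simp add: f_def)
  qed
  have add: "q (x + y) = q x + q y" for x y
    using superadd sublinear_add[OF q] by (meson antisym)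
  have minus: "q (- x) = - q x" for x
    using add[of x "- x"] sublinear_zero[OF q] by simp
  show ?thesis
  proof (rule linearI)
    show "q (r *\<^sub>R x) = r *\<^sub>R q x" for r x
    proof (cases r "0::real" rule: linorder_cases)
      case less
      then show ?thesis using sublinear_scaleR[OF q, of "- r" x] minus[of "r *\<^sub>R x"] by simp
    qed (use q in \<open>simp_all add: sublinear_zero sublinear_scaleR\<close>)
  qed (rule add)
qed

text \<open>Zorn's lemma for the reversed pointwise order on the sublinear minorants of
  \<open>p\<close> gives a minimal one, which is linear by
  \<open>minimal_sublinear_imp_linear\<close>. A nonempty chain is bounded below by its pointwise
  infimum, the empty one by \<open>p\<close>.\<close>

theorem hahn_banach_sublinear:
  assumes p: "sublinear p"
  obtains l where "linear l" "\<And>x. l x \<le> p x"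
proof -
  define A where "A = {q. sublinear q \<and> q \<le> p}"
  have po: "partial_order_on A (relation_of (\<ge>) A)"
    by (intro partial_order_on_relation_ofI) auto
  have "\<exists>m\<in>A. \<forall>q\<in>A. m \<ge> q \<longrightarrow> q = m"
  proof (rule predicate_Zorn[OF po])
    fix C assume "C \<in> Chains (relation_of (\<ge>) A)"
    then have C: "C \<subseteq> A" and chain: "\<And>q r. q \<in> C \<Longrightarrow> r \<in> C \<Longrightarrow> q \<le> r \<or> r \<le> q"
      unfolding Chains_def relation_of_def by auto
    show "\<exists>u\<in>A. \<forall>q\<in>C. q \<ge> u"
    proof (cases "C = {}")
      case True
      then show ?thesis using p by (auto simp: A_def)
    next
      case False
      define u where "u x = (INF q\<in>C. q x)" for x
      have lower: "- p (- x) \<le> q x" if "q \<in> C" for q x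
      proof -
        have "sublinear q" "q (- x) \<le> p (- x)"
          using C that by (auto simp: A_def le_fun_def)
        then show ?thesis using sublinear_ge_minus[of q x] by linarith
      qed
      have u_le: "u x \<le> q x" if "q \<in> C" for q x
        unfolding u_def using lower that
        by (intro cINF_lower bdd_belowI2[where m = "- p (- x)"]) auto
      have "sublinear u"
      proof (rule sublinearI)
        fix x y
        have "u (x + y) \<le> q x + r y" if qr: "q \<in> C" "r \<in> C" for q r
        proof -
          \<comment> \<open>The two infima range over independent members \<open>q\<close> and
            \<open>r\<close>; the chain supplies one member below both, whose subadditivity
            serves.\<close>
          obtain s where s: "s \<in> C" "s \<le> q" "s \<le> r" using chain[OF qr] qr by blast
          then have "sublinear s" using C by (auto simp: A_def)
          then have "s (x + y) \<le> s x + s y" by (rule sublinear_add)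
          moreover have "s x \<le> q x" "s y \<le> r y" using s by (auto simp: le_fun_def)
          ultimately show ?thesis using u_le[OF s(1), of "x + y"] by linarith
        qed
        then show "u (x + y) \<le> u x + u y"
          unfolding u_def[of x] u_def[of y] using False by (intro le_cINF_add) auto
      next
        fix t :: real and x assume t: "t > 0"
        have "u (t *\<^sub>R x) \<le> t * q x" if "q \<in> C" for q
        proof -
          have "sublinear q" using C that by (auto simp: A_def)
          then show ?thesis using u_le[OF that, of "t *\<^sub>R x"] sublinear_scaleR[of q t x] t by simp
        qed
        then show "u (t *\<^sub>R x) \<le> t * u x"
          unfolding u_def[of x] using False t by (intro le_mult_cINF) auto
      qed
      moreover have "u \<le> p"
      proof (rule le_funI)
        fix x
        obtain q where "q \<in> C" using False by blast
        then show "u x \<le> p x"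
          using u_le[of q x] C by (auto simp: A_def le_fun_def intro: order_trans)
      qed
      ultimately have "u \<in> A" by (simp add: A_def)
      then show ?thesis using u_le by (auto simp: le_fun_def)
    qed
  qed
  then obtain m where m: "m \<in> A" and min: "\<And>q. q \<in> A \<Longrightarrow> q \<le> m \<Longrightarrow> q = m" by blast
  have "linear m"
  proof (rule minimal_sublinear_imp_linear)
    show "sublinear m" using m by (simp add: A_def)
    show "q = m" if "sublinear q" "\<And>x. q x \<le> m x" for q
      using min[of q] m that by (auto simp: A_def le_fun_def intro: order_trans)
  qed
  then show thesis
    using that m by (auto simp: A_def le_fun_def)
qed

section \<open>Separation and Fenchel duality\<close>

text \<open>The lower boundary \<open>p\<close> of the cone generated by \<open>C\<close> is
  sublinear, and a linear minorant of \<open>p\<close> lies below \<open>C\<close>.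
  \<open>absorbing\<close> bounds \<open>p\<close> from above and, together with
  \<open>nonneg\<close>, from below.\<close>

lemma linear_minorant_of_convex_epigraph:
  fixes C :: "('a::real_vector \<times> real) set"
  assumes convex: "convex C"
    and absorbing: "\<And>v. \<exists>s>0. \<exists>y c. (y, c) \<in> C \<and> s *\<^sub>R y = v"
    and nonneg: "\<And>c. (0, c) \<in> C \<Longrightarrow> c \<ge> 0"
  obtains l where "linear l" "\<And>y c. (y, c) \<in> C \<Longrightarrow> l y \<le> c"
proof -
  define S where "S v = {s * c | s c y. s > 0 \<and> (y, c) \<in> C \<and> s *\<^sub>R y = v}" for v
  have S_ne: "S v \<noteq> {}" for v using absorbing[of v] by (auto simp: S_def)
  have S_add: "a + b \<in> S (v + w)" if a: "a \<in> S v" and b: "b \<in> S w" for a b v w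
  proof -
    obtain s c y where 1: "a = s * c" "s > 0" "(y, c) \<in> C" "s *\<^sub>R y = v"
      using a by (auto simp: S_def)
    obtain t d z where 2: "b = t * d" "t > 0" "(z, d) \<in> C" "t *\<^sub>R z = w"
      using b by (auto simp: S_def)
    \<comment> \<open>Scaled back by \<open>s + t\<close>, this convex combination is the sum of the
      two given points of the cone.\<close>
    have "(s / (s + t)) *\<^sub>R (y, c) + (t / (s + t)) *\<^sub>R (z, d) \<in> C"
      using 1(2,3) 2(2,3)
      by (intro convexD[OF convex]) (simp_all add: add_divide_distrib[symmetric])
    moreover have "(s + t) *\<^sub>R ((s / (s + t)) *\<^sub>R y + (t / (s + t)) *\<^sub>R z) = v + w"
      using 1 2 by (simp add: scaleR_right_distrib)
    moreover have "(s + t) * (s / (s + t) * c + t / (s + t) * d) = a + b"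
      using 1 2 by (simp add: distrib_left)
    ultimately show ?thesis
      using 1 2 unfolding S_def
      by (intro CollectI exI[of _ "s + t"] exI[of _ "s / (s + t) * c + t / (s + t) * d"]) auto
  qed
  have S_0: "a \<ge> 0" if "a \<in> S 0" for a
    using that nonneg by (auto simp: S_def)
  define p where "p v = Inf (S v)" for v
  have p_le: "p v \<le> a" if "a \<in> S v" for v a
  proof -
    \<comment> \<open>Any \<open>b\<close> in \<open>S (- v)\<close> bounds \<open>S v\<close>
      below, since sums of the two kinds lie in \<open>S 0\<close>.\<close>
    obtain b where "b \<in> S (- v)" using S_ne by blast
    then have "- b \<le> a'" if "a' \<in> S v" for a' using S_0 S_add[OF that] by force
    then show ?thesis unfolding p_def using that by (intro cInf_lower bdd_belowI) auto
  qed
  have "sublinear p"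
  proof (rule sublinearI)
    fix v w
    have "p (v + w) \<le> (INF a\<in>S v. a) + (INF b\<in>S w. b)"
      using S_ne p_le[OF S_add] by (intro le_cINF_add) auto
    then show "p (v + w) \<le> p v + p w" by (simp add: p_def)
  next
    fix t :: real and v assume t: "t > 0"
    have "t * a \<in> S (t *\<^sub>R v)" if a: "a \<in> S v" for a
    proof -
      obtain s c y where "a = s * c" "s > 0" "(y, c) \<in> C" "s *\<^sub>R y = v"
        using a by (auto simp: S_def)
      then show ?thesis
        unfolding S_def using t
        by (intro CollectI exI[of _ "t * s"] exI[of _ c] exI[of _ y]) auto
    qed
    then have "p (t *\<^sub>R v) \<le> t * (INF a\<in>S v. a)"
      using S_ne t p_le by (intro le_mult_cINF) auto
    then show "p (t *\<^sub>R v) \<le> t * p v" by (simp add: p_def)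
  qed
  then obtain l where l: "linear l" "\<And>v. l v \<le> p v" using hahn_banach_sublinear by blast
  have "l y \<le> c" if "(y, c) \<in> C" for y c
  proof -
    have "1 * c \<in> S y" unfolding S_def using that
      by (intro CollectI exI[of _ "1::real"] exI[of _ c] exI[of _ y]) auto
    then show ?thesis using p_le[of "1 * c" y] l(2)[of y] by simp
  qed
  with l(1) show thesis by (rule that)
qed

text \<open>Near 0 the functional stays below \<open>g 0 + 1\<close>. Rescaling each vector to norm
  \<open>d / 2\<close> carries this over to all vectors, and the bound at \<open>- u\<close> gives
  the absolute value.\<close>

lemma bounded_linear_of_le_isCont:
  fixes l :: "'a::real_normed_vector \<Rightarrow> real"
  assumes "linear l" and le: "\<And>u. l u \<le> g u" and "isCont g 0"
  shows "bounded_linear l"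
proof -
  interpret linear l by fact
  obtain d where d: "d > 0" "\<And>u. norm u < d \<Longrightarrow> \<bar>g u - g 0\<bar> < 1"
    using assms(3) unfolding continuous_at_eps_delta dist_norm
    by (metis diff_zero real_norm_def zero_less_one)
  define B where "B = (g 0 + 1) * 2 / d"
  have le': "l u \<le> norm u * B" for u
  proof (cases "u = 0")
    case False
    define t where "t = d / (2 * norm u)"
    have t: "t > 0" using False d by (simp add: t_def)
    have "norm (t *\<^sub>R u) < d" using False d t by (simp add: t_def)
    then have "g (t *\<^sub>R u) < g 0 + 1" using d(2) by fastforce
    then have "t * l u \<le> g 0 + 1" using le[of "t *\<^sub>R u"] by (simp add: scale)
    then have "l u \<le> (g 0 + 1) / t" using t by (simp add: field_simps)
    also have "\<dots> = norm u * B" by (simp add: t_def B_def)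
    finally show ?thesis .
  qed (simp add: zero)
  have "norm (l u) \<le> norm u * B" for u
    using le'[of u] le'[of "- u"] by (simp add: neg)
  then show ?thesis
    using assms(1) by (intro bounded_linear_intro[where K = B]) (auto simp: add scale)
qed


text \<open>Duality written without conjugates: the infima over \<open>w\<close> and over
  \<open>u\<close> may be taken separately. The functional comes from the infimal convolution of
  \<open>h\<close> with the reflection of \<open>g\<close>; \<open>C\<close> consists of points on
  or above its graph, lowered by \<open>d\<close>. Continuity of the finite function
  \<open>g\<close> makes \<open>l\<close> bounded.\<close>

lemma fenchel_rockafellar:
  fixes h :: "'a::real_normed_vector \<Rightarrow> ereal" and g :: "'a \<Rightarrow> real"
  assumes convex_h: "convex_ereal h" and finite: "h w0 \<le> ereal r0"
    and convex_g: "convex_on UNIV g" and cont_g: "continuous_on UNIV g"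
    and le: "\<And>w r. h w \<le> ereal r \<Longrightarrow> d \<le> r + g w"
  obtains l where "bounded_linear l"
    and "\<And>w r u. h w \<le> ereal r \<Longrightarrow> d \<le> r - l w + g u + l u"
proof -
  define C where "C = {(w - u, r + s - d) | w r u s. h w \<le> ereal r \<and> g u \<le> s}"
  have "convex C"
  proof (rule convexI)
    fix p q and a b :: real
    assume "p \<in> C" "q \<in> C" and ab: "0 \<le> a" "0 \<le> b" "a + b = 1"
    then obtain w r u s w' r' u' s' where
      p: "p = (w - u, r + s - d)" "h w \<le> ereal r" "g u \<le> s" and
      q: "q = (w' - u', r' + s' - d)" "h w' \<le> ereal r'" "g u' \<le> s'"
      unfolding C_def by blast
    have "h (a *\<^sub>R w + b *\<^sub>R w') \<le> ereal (a * r + b * r')"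
      using convexD[OF convex_h[unfolded convex_ereal_def], of "(w, r)" "(w', r')" a b] p q ab
      by simp
    moreover have "g (a *\<^sub>R u + b *\<^sub>R u') \<le> a * s + b * s'"
    proof -
      have "g (a *\<^sub>R u + b *\<^sub>R u') \<le> a * g u + b * g u'"
        using convex_g ab by (simp add: convex_on_def)
      also have "\<dots> \<le> a * s + b * s'"
        using p q ab by (intro add_mono mult_left_mono)
      finally show ?thesis .
    qed
    moreover have "a *\<^sub>R p + b *\<^sub>R q =
        ((a *\<^sub>R w + b *\<^sub>R w') - (a *\<^sub>R u + b *\<^sub>R u'), (a * r + b * r') + (a * s + b * s') - d)"
    proof -
      have "d = a * d + b * d" using ab(3) by (metis distrib_right mult_1)
      then show ?thesis unfolding p q by (simp add: algebra_simps)
    qed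
    ultimately show "a *\<^sub>R p + b *\<^sub>R q \<in> C" unfolding C_def by blast
  qed
  moreover have "\<exists>s>0. \<exists>y c. (y, c) \<in> C \<and> s *\<^sub>R y = v" for v
  proof -
    \<comment> \<open>Since \<open>g\<close> is finite everywhere, every \<open>v\<close> is reached
      from \<open>w0\<close> alone, with scaling factor 1.\<close>
    have "(w0 - (w0 - v), r0 + g (w0 - v) - d) \<in> C" unfolding C_def using finite by blast
    then show ?thesis by (intro exI[of _ "1::real"]) auto
  qed
  moreover have "c \<ge> 0" if "(0, c) \<in> C" for c
    using that le by (fastforce simp: C_def)
  ultimately obtain l where l: "linear l" "\<And>y c. (y, c) \<in> C \<Longrightarrow> l y \<le> c"
    using linear_minorant_of_convex_epigraph by metis
  have sep: "d \<le> r - l w + g u + l u" if "h w \<le> ereal r" for w r u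
  proof -
    have "(w - u, r + g u - d) \<in> C" unfolding C_def using that by blast
    then show ?thesis using l(2) linear_diff[OF l(1), of w u] by fastforce
  qed
  have "bounded_linear l"
  proof (rule bounded_linear_of_le_isCont)
    show "l u \<le> r0 - l w0 - d + g (- u)" for u
      using sep[OF finite, of "- u"] linear_neg[OF l(1), of u] by simp
    show "isCont (\<lambda>u. r0 - l w0 - d + g (- u)) 0"
      using continuous_on_compose2[OF cont_g, of UNIV uminus]
      by (intro continuous_intros) (simp add: continuous_on_eq_continuous_at continuous_on_minus continuous_on_id)
  qed (rule l(1))
  then show thesis using sep that by blast
qed

section \<open>Squared norms, conjugates and geometric convergence\<close>

lemma convex_on_power2_norm:
  assumes "linear A"
  shows "convex_on UNIV (\<lambda>u. (norm (A u - a))\<^sup>2)"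
  unfolding convex_on_def
proof (intro conjI ballI allI impI)
  fix x y and s t :: real assume st: "0 \<le> s" "0 \<le> t" "s + t = 1"
  have "a = s *\<^sub>R a + t *\<^sub>R a" using st(3) by (metis scaleR_add_left scaleR_one)
  then have "A (s *\<^sub>R x + t *\<^sub>R y) - a = s *\<^sub>R (A x - a) + t *\<^sub>R (A y - a)"
    by (simp add: linear_add[OF assms] linear_cmul[OF assms] algebra_simps)
  then have "norm (A (s *\<^sub>R x + t *\<^sub>R y) - a) \<le> s * norm (A x - a) + t * norm (A y - a)"
    using norm_triangle_ineq[of "s *\<^sub>R (A x - a)" "t *\<^sub>R (A y - a)"] st by simp
  then have "(norm (A (s *\<^sub>R x + t *\<^sub>R y) - a))\<^sup>2 \<le> (s * norm (A x - a) + t * norm (A y - a))\<^sup>2"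
    by (intro power_mono) auto
  also have "\<dots> \<le> s * (norm (A x - a))\<^sup>2 + t * (norm (A y - a))\<^sup>2"
    using convex_power2 st by (simp add: convex_on_def)
  finally show "(norm (A (s *\<^sub>R x + t *\<^sub>R y) - a))\<^sup>2
      \<le> s * (norm (A x - a))\<^sup>2 + t * (norm (A y - a))\<^sup>2" .
qed simp

text \<open>The conjugate of half the squared norm is half the squared dual norm, with the scale
  \<open>m\<close> inverted. Minimizing along each line bounds \<open>\<bar><v, f>\<bar>\<close>,
  hence the operator norm.\<close>

lemma inf_quadratic_le:
  fixes f :: "'a::real_normed_vector dual"
  assumes le: "\<And>v. c \<le> \<langle>v, f\<rangle> + (norm v / m)\<^sup>2 / 2" and m: "m > 0"
  shows "c \<le> - ((m * norm f)\<^sup>2 / 2)"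
proof -
  have c: "c \<le> 0" using le[of 0] by simp
  have "norm f \<le> sqrt (- 2 * c) / m"
  proof (rule norm_blinfun_bound)
    show "0 \<le> sqrt (- 2 * c) / m" using c m by simp
    fix v
    show "norm \<langle>v, f\<rangle> \<le> sqrt (- 2 * c) / m * norm v"
    proof (cases "v = 0")
      case False
      then have v: "norm v > 0" by simp
      \<comment> \<open>The minimizer in \<open>s\<close> of the quadratic along the line through
        \<open>v\<close>.\<close>
      define s where "s = - \<langle>v, f\<rangle> * m\<^sup>2 / (norm v)\<^sup>2"
      have "c \<le> s * \<langle>v, f\<rangle> + (\<bar>s\<bar> * norm v / m)\<^sup>2 / 2"
        using le[of "s *\<^sub>R v"] by (simp add: blinfun.scaleR_right)
      also have "\<dots> = - ((m * \<langle>v, f\<rangle>)\<^sup>2 / (norm v)\<^sup>2 / 2)"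
        using v m unfolding s_def by (simp add: power2_eq_square field_simps)
      finally have "(m * \<langle>v, f\<rangle>)\<^sup>2 / (norm v)\<^sup>2 \<le> - 2 * c" by simp
      then have "(m * \<langle>v, f\<rangle>)\<^sup>2 \<le> - 2 * c * (norm v)\<^sup>2"
        using v by (simp add: pos_divide_le_eq)
      then have "sqrt ((m * \<langle>v, f\<rangle>)\<^sup>2) \<le> sqrt (- 2 * c * (norm v)\<^sup>2)"
        by (rule real_sqrt_le_mono)
      then have "m * \<bar>\<langle>v, f\<rangle>\<bar> \<le> sqrt (- 2 * c) * norm v"
        unfolding real_sqrt_mult[of "- 2 * c"] using m by (simp add: abs_mult)
      then show ?thesis using m by (simp add: field_simps)
    qed simp
  qed
  then have "m * norm f \<le> sqrt (- 2 * c)" using m by (simp add: field_simps)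
  then have "(m * norm f)\<^sup>2 \<le> (sqrt (- 2 * c))\<^sup>2" using m by (intro power_mono) auto
  then show ?thesis using c by simp
qed

text \<open>A bound on the conjugate is an affine minorant of \<open>h\<close>, a form free of
  subtraction in \<open>ereal\<close>.\<close>

lemma conjugate_le_iff:
  "conjugate h (x', x'') \<le> ereal c \<longleftrightarrow>
    (\<forall>y y'. ereal (\<langle>y, x'\<rangle> + \<langle>y', x''\<rangle> - c) \<le> h (y, y'))"
proof -
  have "ereal a - e \<le> ereal c \<longleftrightarrow> ereal (a - c) \<le> e" for a e
    by (cases e) auto
  then show ?thesis unfolding conjugate_def by (auto simp: SUP_le_iff)
qed

lemma convergent_of_geometric_steps:
  fixes u :: "nat \<Rightarrow> 'b::banach"
  assumes step: "\<And>n. norm (u (Suc n) - u n) \<le> C / 2 ^ n"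
  obtains l where "u \<longlonglongrightarrow> l" "norm (u 0 - l) \<le> 2 * C"
proof -
  have geo: "(\<lambda>n. C / 2 ^ n) sums (2 * C)"
    using sums_mult[OF geometric_sums[of "1 / 2 :: real"], of C]
    by (simp add: power_divide mult.commute)
  have norms: "summable (\<lambda>n. norm (u (Suc n) - u n))"
    using step by (intro summable_comparison_test'[OF sums_summable[OF geo]]) auto
  then have "summable (\<lambda>n. u (Suc n) - u n)" by (rule summable_norm_cancel)
  then have "(\<lambda>n. \<Sum>k<n. u (Suc k) - u k) \<longlonglongrightarrow> (\<Sum>n. u (Suc n) - u n)"
    by (rule summable_LIMSEQ)
  then have "(\<lambda>n. (u n - u 0) + u 0) \<longlonglongrightarrow> (\<Sum>n. u (Suc n) - u n) + u 0"
    unfolding sum_lessThan_telescope by (intro tendsto_intros)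
  then have "u \<longlonglongrightarrow> (\<Sum>n. u (Suc n) - u n) + u 0" by simp
  moreover have "norm (\<Sum>n. u (Suc n) - u n) \<le> 2 * C"
  proof -
    have "norm (\<Sum>n. u (Suc n) - u n) \<le> (\<Sum>n. norm (u (Suc n) - u n))"
      by (rule summable_norm[OF norms])
    also have "\<dots> \<le> (\<Sum>n. C / 2 ^ n)"
      by (rule suminf_le[OF step norms sums_summable[OF geo]])
    finally show ?thesis using sums_unique[OF geo] by simp
  qed
  ultimately show thesis using that by (simp add: norm_minus_commute)
qed

lemma abs_pairing_le: "\<bar>\<langle>x, f\<rangle>\<bar> \<le> norm x * norm f"
  using norm_blinfun[of f x] by (simp add: mult.commute)

section \<open>Convex representations of monotone operators\<close>

text \<open>A locale, since it is interpreted both at the given function and at the Fitzpatrick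
  function of its contact set.\<close>

locale monotone_representation =
  fixes h :: "'a::banach \<times> 'a dual \<Rightarrow> ereal"
  assumes proper: "proper h" and convex: "convex_ereal h" and lsc: "lower_semicontinuous h"
    and ge: "\<And>x x'. h (x, x') \<ge> ereal \<langle>x, x'\<rangle>"
    and conjugate_ge: "\<And>x' x''. conjugate h (x', x'') \<ge> ereal \<langle>x', x''\<rangle>"
begin

definition contact :: "('a \<times> 'a dual) set"
  where "contact = {(x, x'). h (x, x') = ereal \<langle>x, x'\<rangle>}"

text \<open>Otherwise \<open>fenchel_rockafellar\<close> yields a slope \<open>(f, F)\<close> with
  \<open>F\<close> in the bidual, where the hypothesis on the conjugate applies; minimizing over the
  displacements then contradicts \<open>d > 0\<close>. The scale \<open>m\<close> weighs the primal
  norm against the dual one.\<close>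

lemma minty:
  assumes m: "m > 0" and d: "d > 0"
  obtains x x' where "h (x, x') < ereal (\<langle>x, a'\<rangle> + \<langle>a, x'\<rangle> - \<langle>a, a'\<rangle>
    - (norm (x - a) / m)\<^sup>2 / 2 - (m * norm (x' - a'))\<^sup>2 / 2 + d)"
proof (rule ccontr)
  define g where "g u = (norm (fst u - a) / m)\<^sup>2 / 2 + (m * norm (snd u - a'))\<^sup>2 / 2
    - \<langle>fst u, a'\<rangle> - \<langle>a, snd u\<rangle> + \<langle>a, a'\<rangle>" for u
  assume "\<not> thesis"
  with that have not_less: "ereal (d - g (x, x')) \<le> h (x, x')" for x x'
    by (fastforce simp: g_def not_less algebra_simps)
  obtain w0 r0 where w0: "h w0 \<le> ereal r0"
    using proper unfolding proper_def by (metis ereal_real' order_refl)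
  have "convex_on UNIV g"
  proof -
    have "g = (\<lambda>u. (1 / (2 * m\<^sup>2)) * (norm (fst u - a))\<^sup>2 + (m\<^sup>2 / 2) * (norm (snd u - a'))\<^sup>2
        + (\<langle>a, a'\<rangle> - \<langle>fst u, a'\<rangle> - \<langle>a, snd u\<rangle>))"
      by (auto simp: g_def power_divide power_mult_distrib)
    moreover have "convex_on UNIV (\<lambda>u. \<langle>a, a'\<rangle> - \<langle>fst u, a'\<rangle> - \<langle>a, snd u\<rangle>)"
      unfolding convex_on_def
    proof (intro conjI ballI allI impI)
      fix x y :: "'a \<times> 'a dual" and s t :: real assume "s + t = 1"
      then have "\<langle>a, a'\<rangle> = s * \<langle>a, a'\<rangle> + t * \<langle>a, a'\<rangle>" by (metis distrib_right mult_1)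
      then show "\<langle>a, a'\<rangle> - \<langle>fst (s *\<^sub>R x + t *\<^sub>R y), a'\<rangle> - \<langle>a, snd (s *\<^sub>R x + t *\<^sub>R y)\<rangle>
        \<le> s * (\<langle>a, a'\<rangle> - \<langle>fst x, a'\<rangle> - \<langle>a, snd x\<rangle>) + t * (\<langle>a, a'\<rangle> - \<langle>fst y, a'\<rangle> - \<langle>a, snd y\<rangle>)"
        by (simp add: blinfun.bilinear_simps algebra_simps)
    qed simp
    ultimately show ?thesis
      by (simp only:)
        (intro convex_on_add convex_on_cmul convex_on_power2_norm, auto intro: linear_fst linear_snd)
  qed
  moreover have "continuous_on UNIV g"
    unfolding g_def by (intro continuous_intros) (use m in auto)
  moreover have "d \<le> r + g w" if "h w \<le> ereal r" for w r
  proof -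
    have "ereal (d - g w) \<le> h w"
      using not_less[of "fst w" "snd w"] by simp
    with that have "ereal (d - g w) \<le> ereal r" by (rule order_trans[rotated])
    then show ?thesis by simp
  qed
  ultimately obtain l where l: "bounded_linear l"
    and sep: "\<And>w r u. h w \<le> ereal r \<Longrightarrow> d \<le> r - l w + g u + l u"
    using fenchel_rockafellar[OF convex w0] by metis
  interpret l: bounded_linear l by fact
  define f where "f = Blinfun (\<lambda>x. l (x, 0))"
  define F where "F = Blinfun (\<lambda>x'. l (0, x'))"
  have "bounded_linear (\<lambda>x. l (x, 0))" "bounded_linear (\<lambda>x'. l (0, x'))"
    by (intro bounded_linear_compose[OF l] bounded_linear_Pair bounded_linear_ident
        bounded_linear_zero)+
  then have "\<langle>x, f\<rangle> = l (x, 0)" "\<langle>x', F\<rangle> = l (0, x')" for x x'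
    by (simp_all add: f_def F_def bounded_linear_Blinfun_apply)
  then have l_eq: "l (x, x') = \<langle>x, f\<rangle> + \<langle>x', F\<rangle>" for x x'
    using l.add[of "(x, 0)" "(0, x')"] by simp
  \<comment> \<open>By \<open>sep\<close>, \<open>l\<close> minus the constant
    \<open>g u + l u - d\<close> is a minorant of \<open>h\<close>, so this constant dominates the
    conjugate at \<open>(f, F)\<close>.\<close>
  have bound: "\<langle>f, F\<rangle> \<le> g u + l u - d" for u
  proof -
    have "conjugate h (f, F) \<le> ereal (g u + l u - d)"
      unfolding conjugate_le_iff
    proof (intro allI)
      fix y y'
      show "ereal (\<langle>y, f\<rangle> + \<langle>y', F\<rangle> - (g u + l u - d)) \<le> h (y, y')"
        using sep[of "(y, y')" _ u] ge[where x = y and x' = y']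
        by (cases "h (y, y')") (auto simp: l_eq algebra_simps)
    qed
    with conjugate_ge[where x' = f and x'' = F] have "ereal \<langle>f, F\<rangle> \<le> ereal (g u + l u - d)" by (rule order_trans)
    then show ?thesis by simp
  qed
  \<comment> \<open>Recentred slopes: at \<open>u = (a + v, a' + v')\<close> the bound splits into a
    term in \<open>v\<close> and one in \<open>v'\<close>, which are minimized one after the
    other.\<close>
  define f1 where "f1 = f - a'"
  define F1 where "F1 = F - canonical_injection a"
  have "d + \<langle>f1, F1\<rangle> \<le> (\<langle>v, f1\<rangle> + (norm v / m)\<^sup>2 / 2) + (\<langle>v', F1\<rangle> + (norm v' / (1 / m))\<^sup>2 / 2)"
    for v v'
    using bound[of "(a + v, a' + v')"]
    by (simp add: g_def l_eq f1_def F1_def blinfun.bilinear_simps algebra_simps)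
  then have "d + \<langle>f1, F1\<rangle> - (\<langle>v', F1\<rangle> + (norm v' / (1 / m))\<^sup>2 / 2) \<le> - ((m * norm f1)\<^sup>2 / 2)" for v'
    using m by (intro inf_quadratic_le) (simp_all add: algebra_simps)
  then have "d + \<langle>f1, F1\<rangle> + (m * norm f1)\<^sup>2 / 2 \<le> - ((1 / m * norm F1)\<^sup>2 / 2)"
    using m by (intro inf_quadratic_le) (simp_all add: algebra_simps)
  moreover have "- (norm f1 * norm F1) \<le> \<langle>f1, F1\<rangle>"
    using abs_pairing_le[where x = f1 and f = F1] by linarith
  moreover have "norm f1 * norm F1 = (m * norm f1) * (1 / m * norm F1)" using m by simp
  moreover have "0 \<le> (m * norm f1 - 1 / m * norm F1)\<^sup>2" by simp
  ultimately show False using d unfolding power2_diff by linarith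
qed

text \<open>As \<open>h\<close> dominates the pairing, \<open>minty\<close> gives the second bound.
  Its left side is nonnegative because the pairing is at least minus the product of the norms, and
  this yields the first.\<close>

lemma minty_gap:
  assumes m: "m > 0" and d: "d > 0"
  obtains x x' where "h (x, x') < ereal (\<langle>x, x'\<rangle> + d)"
    and "\<langle>x - a, x' - a'\<rangle> + (norm (x - a) / m)\<^sup>2 / 2 + (m * norm (x' - a'))\<^sup>2 / 2 < d"
proof -
  obtain x x' where *: "h (x, x') < ereal (\<langle>x, a'\<rangle> + \<langle>a, x'\<rangle> - \<langle>a, a'\<rangle>
    - (norm (x - a) / m)\<^sup>2 / 2 - (m * norm (x' - a'))\<^sup>2 / 2 + d)"
    using minty[OF assms] .
  have split: "\<langle>x - a, x' - a'\<rangle> = \<langle>x, x'\<rangle> - \<langle>x, a'\<rangle> - \<langle>a, x'\<rangle> + \<langle>a, a'\<rangle>"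
    by (simp add: blinfun.bilinear_simps)
  have "- (norm (x - a) * norm (x' - a')) \<le> \<langle>x - a, x' - a'\<rangle>"
    using abs_pairing_le[where x = "x - a" and f = "x' - a'"] by linarith
  moreover have "norm (x - a) * norm (x' - a') = (norm (x - a) / m) * (m * norm (x' - a'))"
    using m by simp
  moreover have "0 \<le> (norm (x - a) / m - m * norm (x' - a'))\<^sup>2" by simp
  ultimately have "0 \<le> \<langle>x - a, x' - a'\<rangle> + (norm (x - a) / m)\<^sup>2 / 2 + (m * norm (x' - a'))\<^sup>2 / 2"
    unfolding power2_diff by linarith
  then have "h (x, x') < ereal (\<langle>x, x'\<rangle> + d)"
    using split by (intro less_le_trans[OF *]) simp
  moreover have "ereal \<langle>x, x'\<rangle> < ereal (\<langle>x, a'\<rangle> + \<langle>a, x'\<rangle> - \<langle>a, a'\<rangle>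
    - (norm (x - a) / m)\<^sup>2 / 2 - (m * norm (x' - a'))\<^sup>2 / 2 + d)"
    using ge * by (rule le_less_trans)
  ultimately show thesis using that split by simp
qed

text \<open>The pairing at the convex combination equals the combined pairings minus
  \<open>s * t * <x - y, x' - y'>\<close>, while \<open>h\<close> is convex and dominates the
  pairing.\<close>

lemma convex_combination_gap:
  assumes x: "h (x, x') \<le> ereal (\<langle>x, x'\<rangle> + A)" and y: "h (y, y') \<le> ereal (\<langle>y, y'\<rangle> + B)"
    and st: "0 \<le> s" "0 \<le> t" "s + t = 1"
  shows "- (s * A + t * B) \<le> s * t * \<langle>x - y, x' - y'\<rangle>"
proof -
  have "h (s *\<^sub>R x + t *\<^sub>R y, s *\<^sub>R x' + t *\<^sub>R y')
      \<le> ereal (s * (\<langle>x, x'\<rangle> + A) + t * (\<langle>y, y'\<rangle> + B))"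
    using convexD[OF convex[unfolded convex_ereal_def], of "((x, x'), _)" "((y, y'), _)" s t] x y st
    by simp
  with ge have "ereal \<langle>s *\<^sub>R x + t *\<^sub>R y, s *\<^sub>R x' + t *\<^sub>R y'\<rangle>
      \<le> ereal (s * (\<langle>x, x'\<rangle> + A) + t * (\<langle>y, y'\<rangle> + B))" by (rule order_trans)
  then have "\<langle>s *\<^sub>R x + t *\<^sub>R y, s *\<^sub>R x' + t *\<^sub>R y'\<rangle>
      \<le> s * (\<langle>x, x'\<rangle> + A) + t * (\<langle>y, y'\<rangle> + B)" by simp
  moreover have t: "t = 1 - s" using st by simp
  ultimately show ?thesis unfolding t by (simp add: blinfun.bilinear_simps algebra_simps)
qed

text \<open>
  The weights below minimize \<open>\<alpha>\<^sup>2 / t + \<beta>\<^sup>2 / s\<close>; equal weights would give only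
  \<open>- 2 * (\<alpha>\<^sup>2 + \<beta>\<^sup>2)\<close>, which loses the sharp constant of the Bronsted-Rockafellar property.
\<close>

lemma pairing_diff_ge:
  assumes x: "h (x, x') \<le> ereal (\<langle>x, x'\<rangle> + \<alpha>\<^sup>2)" and y: "h (y, y') \<le> ereal (\<langle>y, y'\<rangle> + \<beta>\<^sup>2)"
    and pos: "\<alpha> > 0" "\<beta> > 0"
  shows "- (\<alpha> + \<beta>)\<^sup>2 \<le> \<langle>x - y, x' - y'\<rangle>"
proof -
  define s where "s = \<beta> / (\<alpha> + \<beta>)"
  define t where "t = \<alpha> / (\<alpha> + \<beta>)"
  have "s + t = 1" using pos by (simp add: s_def t_def add_divide_distrib[symmetric])
  then have "- (s * \<alpha>\<^sup>2 + t * \<beta>\<^sup>2) \<le> s * t * \<langle>x - y, x' - y'\<rangle>"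
    using pos by (intro convex_combination_gap[OF x y]) (auto simp: s_def t_def)
  moreover have "s * \<alpha>\<^sup>2 + t * \<beta>\<^sup>2 = s * t * (\<alpha> + \<beta>)\<^sup>2"
  proof -
    have "s * \<alpha>\<^sup>2 + t * \<beta>\<^sup>2 = (\<alpha> + \<beta>) * (\<alpha> * \<beta>) / (\<alpha> + \<beta>)"
      by (simp add: s_def t_def power2_eq_square add_divide_distrib[symmetric] algebra_simps)
    also have "\<dots> = s * t * (\<alpha> + \<beta>)\<^sup>2"
      using pos by (simp add: s_def t_def power2_eq_square)
    finally show ?thesis .
  qed
  ultimately have "s * t * (- (\<alpha> + \<beta>)\<^sup>2) \<le> s * t * \<langle>x - y, x' - y'\<rangle>" by simp
  moreover have "s * t > 0" using pos by (simp add: s_def t_def)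
  ultimately show ?thesis by (rule mult_left_le_imp_le)
qed

text \<open>
  For small \<open>\<delta>\<close> the two weighted norms are almost equal and their squares add up to hardly more
  than \<open>2 * \<alpha>\<^sup>2\<close>, so each of them is hardly more than \<open>\<alpha>\<close>.
\<close>

lemma gap_step:
  assumes gap: "h (a, a') \<le> ereal (\<langle>a, a'\<rangle> + \<alpha>\<^sup>2)" and pos: "\<alpha> > 0" "\<delta> > 0" "m > 0"
  obtains x x' where "h (x, x') \<le> ereal (\<langle>x, x'\<rangle> + \<delta>\<^sup>2)"
    and "norm (x - a) / m < \<alpha> + 3 * \<delta>" and "m * norm (x' - a') < \<alpha> + 3 * \<delta>"
proof -
  obtain x x' where x: "h (x, x') < ereal (\<langle>x, x'\<rangle> + \<delta>\<^sup>2)"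
    and near: "\<langle>x - a, x' - a'\<rangle> + (norm (x - a) / m)\<^sup>2 / 2 + (m * norm (x' - a'))\<^sup>2 / 2 < \<delta>\<^sup>2"
    using minty_gap[where m = m and d = "\<delta>\<^sup>2" and a = a and a' = a'] pos by auto
  define p where "p = norm (x - a) / m"
  define q where "q = m * norm (x' - a')"
  have pq: "0 \<le> p" "0 \<le> q" using pos by (simp_all add: p_def q_def)
  have "- (\<delta> + \<alpha>)\<^sup>2 \<le> \<langle>x - a, x' - a'\<rangle>"
    using pairing_diff_ge[OF less_imp_le[OF x] gap] pos by simp
  then have sum: "p\<^sup>2 + q\<^sup>2 < 2 * \<delta>\<^sup>2 + 2 * (\<delta> + \<alpha>)\<^sup>2"
    using near by (simp add: p_def q_def)
  have "- (p * q) \<le> \<langle>x - a, x' - a'\<rangle>"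
    using abs_pairing_le[where x = "x - a" and f = "x' - a'"] pos
    by (simp add: p_def q_def abs_le_iff)
  then have diff: "(p - q)\<^sup>2 < 2 * \<delta>\<^sup>2"
    using near unfolding power2_diff p_def[symmetric] q_def[symmetric] by simp
  have *: "b < \<alpha> + 3 * \<delta>"
    if bc: "0 \<le> b" "0 \<le> c" "b\<^sup>2 + c\<^sup>2 < 2 * \<delta>\<^sup>2 + 2 * (\<delta> + \<alpha>)\<^sup>2" "(b - c)\<^sup>2 < 2 * \<delta>\<^sup>2" for b c
  proof (rule ccontr)
    assume "\<not> ?thesis"
    then have b: "\<alpha> + 3 * \<delta> \<le> b" by simp
    \<comment> \<open>The factor \<open>3 / 2\<close> replaces the square root of 2. It keeps
      \<open>c\<close> within \<open>3 / 2 * \<delta>\<close> below \<open>b\<close>, and then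
      \<open>b\<close> and \<open>c\<close> are too large for the bound on the sum of
      squares.\<close>
    have "(3 / 2 * \<delta>)\<^sup>2 = 9 / 4 * \<delta>\<^sup>2" by (simp add: power2_eq_square)
    moreover have "\<delta>\<^sup>2 > 0" using pos by simp
    ultimately have "(b - c)\<^sup>2 < (3 / 2 * \<delta>)\<^sup>2" using bc(4) by linarith
    then have "b - c < 3 / 2 * \<delta>" using pos by (intro power2_less_imp_less[of "b - c"]) auto
    then have "\<alpha> + 3 / 2 * \<delta> \<le> c" using b by simp
    then have "(\<alpha> + 3 / 2 * \<delta>)\<^sup>2 \<le> c\<^sup>2" "(\<alpha> + 3 * \<delta>)\<^sup>2 \<le> b\<^sup>2"
      using b pos by (auto intro: power_mono)
    moreover have "\<alpha> * \<delta> > 0" "\<delta> * \<delta> > 0" using pos by auto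
    ultimately show False using bc(3) by (simp add: power2_eq_square algebra_simps)
  qed
  have "p < \<alpha> + 3 * \<delta>" using * pq sum diff by blast
  moreover have "q < \<alpha> + 3 * \<delta>" using *[of q p] pq sum diff by (simp add: power2_commute)
  ultimately show thesis using that[OF less_imp_le[OF x]] by (simp add: p_def q_def)
qed

text \<open>Lower semicontinuity carries the vanishing gap over to the limit, where
  \<open>ge\<close> forces equality.\<close>

lemma contact_limit:
  assumes u: "u \<longlonglongrightarrow> x" "u' \<longlonglongrightarrow> x'" and e: "e \<longlonglongrightarrow> 0"
    and le: "\<And>n. h (u n, u' n) \<le> ereal (\<langle>u n, u' n\<rangle> + e n)"
  shows "(x, x') \<in> contact"
proof (rule ccontr)
  assume "(x, x') \<notin> contact"
  then have "ereal \<langle>x, x'\<rangle> < h (x, x')" using ge[where x = x and x' = x'] by (auto simp: contact_def)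
  then obtain c where c: "ereal \<langle>x, x'\<rangle> < ereal c" "ereal c < h (x, x')"
    using ereal_dense2 by blast
  have "ereal c < Liminf (at (x, x')) h"
    using c(2) lsc unfolding lower_semicontinuous_def by (meson less_le_trans)
  then have "eventually (\<lambda>z. ereal c < h z) (at (x, x'))" by (rule less_LiminfD)
  \<comment> \<open>The filter \<open>at\<close> leaves out the limit point, which the sequence may
    visit; \<open>c(2)\<close> adds it.\<close>
  then have "eventually (\<lambda>z. ereal c < h z) (nhds (x, x'))"
    using c(2) by (simp add: eventually_nhds_conv_at)
  moreover have "(\<lambda>n. (u n, u' n)) \<longlonglongrightarrow> (x, x')" using u by (rule tendsto_Pair)
  ultimately have "eventually (\<lambda>n. ereal c < h (u n, u' n)) sequentially"
    unfolding filterlim_iff by blast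
  moreover have "(\<lambda>n. \<langle>u n, u' n\<rangle> + e n) \<longlonglongrightarrow> \<langle>x, x'\<rangle> + 0"
    using u e by (intro tendsto_intros)
  then have "eventually (\<lambda>n. \<langle>u n, u' n\<rangle> + e n < c) sequentially"
    using c(1) by (intro order_tendstoD(2)) auto
  ultimately have "eventually (\<lambda>n. False) sequentially"
  proof eventually_elim
    case (elim n)
    then show False using le[of n] by (metis ereal_less_eq(3) leD less_imp_le order_less_le_trans)
  qed
  then show False by simp
qed

text \<open>\<open>gap_step\<close> is iterated, halving \<open>\<alpha>\<close> each time. Step
  \<open>n\<close> has weighted length at most
  \<open>\<alpha> / 2 ^ n + 3 * (\<alpha> / 2 ^ Suc n)\<close>, which is
  \<open>5 / 2 * \<alpha> / 2 ^ n\<close>, and these sum to \<open>5 * \<alpha>\<close>.\<close>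

lemma contact_near_gap:
  assumes gap: "h (a, a') \<le> ereal (\<langle>a, a'\<rangle> + \<alpha>\<^sup>2)" and pos: "\<alpha> > 0" "m > 0"
  obtains x x' where "(x, x') \<in> contact"
    and "norm (a - x) / m \<le> 5 * \<alpha>" and "m * norm (a' - x') \<le> 5 * \<alpha>"
proof -
  \<comment> \<open>The clause for \<open>n = 0\<close> pins the starting point, which dependent
    choice would leave open.\<close>
  define P where "P n z \<longleftrightarrow>
      h z \<le> ereal (\<langle>fst z, snd z\<rangle> + (\<alpha> / 2 ^ n)\<^sup>2) \<and> (n = 0 \<longrightarrow> z = (a, a'))" for n and z :: "'a \<times> 'a dual"
  define Q where "Q n z w \<longleftrightarrow> norm (fst w - fst z) / m \<le> 5 / 2 * \<alpha> / 2 ^ n \<and>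
      m * norm (snd w - snd z) \<le> 5 / 2 * \<alpha> / 2 ^ n" for n :: nat and z w :: "'a \<times> 'a dual"
  have "\<exists>z. \<forall>n. P n (z n) \<and> Q n (z n) (z (Suc n))"
  proof (rule dependent_nat_choice)
    show "\<exists>z. P 0 z" using gap by (intro exI[of _ "(a, a')"]) (simp add: P_def)
    fix z n assume "P n z"
    then have gap_n: "h (fst z, snd z) \<le> ereal (\<langle>fst z, snd z\<rangle> + (\<alpha> / 2 ^ n)\<^sup>2)"
      by (simp add: P_def)
    have "\<alpha> / 2 ^ n > 0" "\<alpha> / 2 ^ Suc n > 0" using pos by simp_all
    from gap_step[OF gap_n this pos(2)] obtain x x' where "h (x, x') \<le> ereal (\<langle>x, x'\<rangle> + (\<alpha> / 2 ^ Suc n)\<^sup>2)"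
      and "norm (x - fst z) / m < \<alpha> / 2 ^ n + 3 * (\<alpha> / 2 ^ Suc n)"
      and "m * norm (x' - snd z) < \<alpha> / 2 ^ n + 3 * (\<alpha> / 2 ^ Suc n)"
      by metis
    then show "\<exists>w. P (Suc n) w \<and> Q n z w"
      by (intro exI[of _ "(x, x')"]) (simp add: P_def Q_def)
  qed
  then obtain z where P: "\<And>n. P n (z n)" and Q: "\<And>n. Q n (z n) (z (Suc n))" by blast
  define u where "u n = fst (z n)" for n
  define u' where "u' n = snd (z n)" for n
  have 0: "u 0 = a" "u' 0 = a'" using P[of 0] by (simp_all add: P_def u_def u'_def)
  have "norm (u (Suc n) - u n) \<le> 5 / 2 * \<alpha> * m / 2 ^ n" for n
    using Q[of n] pos by (simp add: Q_def u_def field_simps)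
  then obtain x where x: "u \<longlonglongrightarrow> x" "norm (u 0 - x) \<le> 2 * (5 / 2 * \<alpha> * m)"
    by (rule convergent_of_geometric_steps)
  have "norm (u' (Suc n) - u' n) \<le> 5 / 2 * \<alpha> / m / 2 ^ n" for n
    using Q[of n] pos by (simp add: Q_def u'_def field_simps)
  then obtain x' where x': "u' \<longlonglongrightarrow> x'" "norm (u' 0 - x') \<le> 2 * (5 / 2 * \<alpha> / m)"
    by (rule convergent_of_geometric_steps)
  have "(\<lambda>n. (\<alpha> * (1 / 2) ^ n)\<^sup>2) \<longlonglongrightarrow> (\<alpha> * 0)\<^sup>2"
    by (intro tendsto_intros LIMSEQ_power_zero) simp
  then have "(\<lambda>n. (\<alpha> / 2 ^ n)\<^sup>2) \<longlonglongrightarrow> 0" by (simp add: power_divide)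
  then have "(x, x') \<in> contact"
    using P by (intro contact_limit[OF x(1) x'(1), where e = "\<lambda>n. (\<alpha> / 2 ^ n)\<^sup>2"])
      (simp_all add: P_def u_def u'_def)
  then show thesis
    using x(2) x'(2) pos by (intro that) (simp_all add: 0 field_simps)
qed

text \<open>Iterating from the start would cost \<open>5 * \<alpha>\<close>. A single step straight
  down to gap \<open>\<delta>\<^sup>2\<close> costs less than
  \<open>\<alpha> + 3 * \<delta>\<close>, the iteration after it at most
  \<open>5 * \<delta>\<close>, and the sum is \<open>\<beta>\<close>.\<close>

lemma bronsted_rockafellar:
  assumes gap: "h (a, a') \<le> ereal (\<langle>a, a'\<rangle> + \<alpha>\<^sup>2)" and pos: "\<alpha> > 0" "\<alpha> < \<beta>" "m > 0"
  obtains x x' where "(x, x') \<in> contact"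
    and "norm (a - x) / m < \<beta>" and "m * norm (a' - x') < \<beta>"
proof -
  define \<delta> where "\<delta> = (\<beta> - \<alpha>) / 8"
  have \<delta>: "\<delta> > 0" "\<beta> = \<alpha> + 8 * \<delta>" using pos by (simp_all add: \<delta>_def field_simps)
  obtain y y' where y: "h (y, y') \<le> ereal (\<langle>y, y'\<rangle> + \<delta>\<^sup>2)"
    "norm (y - a) / m < \<alpha> + 3 * \<delta>" "m * norm (y' - a') < \<alpha> + 3 * \<delta>"
    using gap_step[OF gap] pos \<delta> by metis
  obtain x x' where x: "(x, x') \<in> contact"
    "norm (y - x) / m \<le> 5 * \<delta>" "m * norm (y' - x') \<le> 5 * \<delta>"
    using contact_near_gap[OF y(1)] pos \<delta> by metis
  have "norm (a - x) / m \<le> norm (y - a) / m + norm (y - x) / m"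
    using norm_triangle_ineq4[of "y - x" "y - a"] pos
    by (simp add: divide_right_mono flip: add_divide_distrib)
  moreover have "m * norm (a' - x') \<le> m * norm (y' - a') + m * norm (y' - x')"
    using norm_triangle_ineq4[of "y' - x'" "y' - a'"] pos
    by (simp flip: distrib_left)
  ultimately show thesis using that x y \<delta> by fastforce
qed

section \<open>Maximal monotonicity and the conjugate\<close>

lemma contact_pairing_diff_nonneg:
  assumes "(x, x') \<in> contact" "(y, y') \<in> contact"
  shows "0 \<le> \<langle>x - y, x' - y'\<rangle>"
  using assms convex_combination_gap[of x x' 0 y y' 0 "1 / 2" "1 / 2"] by (simp add: contact_def)

text \<open>Approximate minimizers around \<open>(a, a')\<close> have small gap, so contact points
  lie close to them. Being related to those bounds \<open><x - a, x' - a'>\<close> from below up to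
  small errors, which drives the minimizers, and the contact points with them, to
  \<open>(a, a')\<close>.\<close>

lemma contact_maximal:
  assumes related: "\<And>y y'. (y, y') \<in> contact \<Longrightarrow> 0 \<le> \<langle>a - y, a' - y'\<rangle>"
  shows "(a, a') \<in> contact"
proof -
  have near: "\<exists>w. w \<in> contact \<and> norm (fst w - a) \<le> 25 * \<delta> \<and> norm (snd w - a') \<le> 25 * \<delta>"
    if \<delta>: "\<delta> > 0" for \<delta>
  proof -
    obtain x x' where x: "h (x, x') < ereal (\<langle>x, x'\<rangle> + \<delta>\<^sup>2)"
      and x_near: "\<langle>x - a, x' - a'\<rangle> + (norm (x - a))\<^sup>2 / 2 + (norm (x' - a'))\<^sup>2 / 2 < \<delta>\<^sup>2"
      using minty_gap[where m = 1 and d = "\<delta>\<^sup>2" and a = a and a' = a'] \<delta> by auto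
    obtain y y' where y: "(y, y') \<in> contact" "norm (x - y) \<le> 5 * \<delta>" "norm (x' - y') \<le> 5 * \<delta>"
      using contact_near_gap[OF less_imp_le[OF x] \<delta>, of 1] by auto
    define p where "p = norm (x - a)"
    define q where "q = norm (x' - a')"
    have "norm (y - a) \<le> p + 5 * \<delta>"
      using norm_triangle_ineq4[of "x - a" "x - y"] y by (simp add: p_def)
    have "norm (y' - a') \<le> q + 5 * \<delta>"
      using norm_triangle_ineq4[of "x' - a'" "x' - y'"] y by (simp add: q_def)
    have "\<langle>x - a, x' - a'\<rangle> =
        \<langle>a - y, a' - y'\<rangle> + \<langle>x - y, x' - a'\<rangle> + \<langle>x - a, x' - y'\<rangle> - \<langle>x - y, x' - y'\<rangle>"
      by (simp add: blinfun.bilinear_simps algebra_simps)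
    moreover have "\<bar>\<langle>x - y, x' - a'\<rangle>\<bar> \<le> (5 * \<delta>) * q"
      using y by (intro order_trans[OF abs_pairing_le]) (auto simp: q_def intro!: mult_right_mono)
    moreover have "\<bar>\<langle>x - a, x' - y'\<rangle>\<bar> \<le> p * (5 * \<delta>)"
      using y by (intro order_trans[OF abs_pairing_le]) (auto simp: p_def intro!: mult_left_mono)
    moreover have "\<bar>\<langle>x - y, x' - y'\<rangle>\<bar> \<le> (5 * \<delta>) * (5 * \<delta>)"
      using y \<delta> by (intro order_trans[OF abs_pairing_le] mult_mono) auto
    \<comment> \<open>52 is twice \<open>1 + 25\<close>, from \<open>x_near\<close> and the last
      error term. Completing squares gives 102, less than the square of 15; so \<open>p\<close> and
      \<open>q\<close> are below \<open>20 * \<delta>\<close>, and passing to \<open>(y, y')\<close>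
      adds \<open>5 * \<delta>\<close>.\<close>
    ultimately have "p\<^sup>2 + q\<^sup>2 < 52 * \<delta>\<^sup>2 + 10 * \<delta> * (p + q)"
      using x_near related[OF y(1)]
      by (simp add: p_def q_def power2_eq_square algebra_simps)
    then have "(p - 5 * \<delta>)\<^sup>2 + (q - 5 * \<delta>)\<^sup>2 < 102 * \<delta>\<^sup>2"
      by (simp add: power2_eq_square algebra_simps)
    moreover have "(15 * \<delta>)\<^sup>2 = 225 * \<delta>\<^sup>2" by (simp add: power2_eq_square)
    moreover have "0 < \<delta>\<^sup>2" "0 \<le> (p - 5 * \<delta>)\<^sup>2" "0 \<le> (q - 5 * \<delta>)\<^sup>2" using \<delta> by simp_all
    ultimately have sq: "(p - 5 * \<delta>)\<^sup>2 < (15 * \<delta>)\<^sup>2" "(q - 5 * \<delta>)\<^sup>2 < (15 * \<delta>)\<^sup>2"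
      by linarith+
    have "p - 5 * \<delta> < 15 * \<delta>" "q - 5 * \<delta> < 15 * \<delta>"
      by (rule power2_less_imp_less[OF sq(1)] power2_less_imp_less[OF sq(2)], use \<delta> in simp)+
    then have "norm (y - a) \<le> 25 * \<delta>" "norm (y' - a') \<le> 25 * \<delta>"
      using \<open>norm (y - a) \<le> p + 5 * \<delta>\<close> \<open>norm (y' - a') \<le> q + 5 * \<delta>\<close> by linarith+
    then show ?thesis using y(1) by (intro exI[of _ "(y, y')"]) simp
  qed
  have "\<exists>w. \<forall>n. w n \<in> contact \<and> norm (fst (w n) - a) \<le> 25 * inverse (real (Suc n)) \<and>
      norm (snd (w n) - a') \<le> 25 * inverse (real (Suc n))"
    using near by (intro choice allI) simp
  then obtain w where w: "\<And>n. w n \<in> contact" "\<And>n. norm (fst (w n) - a) \<le> 25 * inverse (real (Suc n))"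
      "\<And>n. norm (snd (w n) - a') \<le> 25 * inverse (real (Suc n))" by blast
  have 0: "(\<lambda>n. 25 * inverse (real (Suc n))) \<longlonglongrightarrow> 0"
    using tendsto_mult[OF tendsto_const LIMSEQ_inverse_real_of_nat, of 25] by simp
  have "(\<lambda>n. fst (w n) - a) \<longlonglongrightarrow> 0" "(\<lambda>n. snd (w n) - a') \<longlonglongrightarrow> 0"
    by (rule Lim_null_comparison[OF _ 0]; use w in simp)+
  then have "(\<lambda>n. fst (w n)) \<longlonglongrightarrow> a" "(\<lambda>n. snd (w n)) \<longlonglongrightarrow> a'"
    by (simp_all add: LIM_zero_cancel)
  then show ?thesis
    using w(1) by (intro contact_limit[where e = "\<lambda>n. 0"]) (auto simp: contact_def split_beta)
qed

lemma maximal_monotone_contact: "maximal_monotone contact"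
  unfolding maximal_monotone_def
proof (intro conjI allI impI)
  show "monotone_operator contact"
    using contact_pairing_diff_nonneg by (auto simp: monotone_operator_def)
  fix S assume "monotone_operator S" "contact \<subseteq> S"
  then have "(x, x') \<in> contact" if "(x, x') \<in> S" for x x'
    using that by (intro contact_maximal) (fastforce simp: monotone_operator_def)
  then show "S = contact" using \<open>contact \<subseteq> S\<close> by auto
qed

text \<open>In other words, \<open>(x', x)\<close> is a subgradient of \<open>h\<close> at
  \<open>(x, x')\<close>. Convexity along the segment, divided by the weight \<open>1 - s\<close> of
  \<open>(y, y')\<close>, gives it as \<open>s\<close> tends to 1.\<close>

lemma contact_tangent:
  assumes "(x, x') \<in> contact"
  shows "ereal (\<langle>y, x'\<rangle> + \<langle>x, y'\<rangle> - \<langle>x, x'\<rangle>) \<le> h (y, y')"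
proof (cases "h (y, y')")
  case (real r)
  have "s * - \<langle>x - y, x' - y'\<rangle> \<le> r - \<langle>y, y'\<rangle>" if s: "0 < s" "s < 1" for s
  proof -
    have "- (s * 0 + (1 - s) * (r - \<langle>y, y'\<rangle>)) \<le> s * (1 - s) * \<langle>x - y, x' - y'\<rangle>"
      using s assms real by (intro convex_combination_gap) (auto simp: contact_def)
    then have "(1 - s) * (s * - \<langle>x - y, x' - y'\<rangle>) \<le> (1 - s) * (r - \<langle>y, y'\<rangle>)"
      by (simp add: algebra_simps)
    then show ?thesis by (rule mult_left_le_imp_le) (use s in simp)
  qed
  then have "- \<langle>x - y, x' - y'\<rangle> \<le> r - \<langle>y, y'\<rangle>" by (rule field_le_mult_one_interval)
  then show ?thesis using real by (simp add: blinfun.bilinear_simps)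
qed (use ge[where x = y and x' = y'] in auto)

text \<open>Tangency bounds the conjugate at contact points. Conversely, such a bound tested against
  contact points says that \<open>(x, x')\<close> is monotonically related to them, so
  \<open>contact_maximal\<close> applies; no biconjugate is involved.\<close>

lemma contact_eq_conjugate:
  "contact = {(x, x'). conjugate h (x', canonical_injection x) = ereal \<langle>x, x'\<rangle>}"
proof -
  have "(x, x') \<in> contact \<longleftrightarrow> conjugate h (x', canonical_injection x) \<le> ereal \<langle>x, x'\<rangle>" for x x'
  proof
    assume "(x, x') \<in> contact"
    then show "conjugate h (x', canonical_injection x) \<le> ereal \<langle>x, x'\<rangle>"
      using contact_tangent by (simp add: conjugate_le_iff)
  next
    assume le: "conjugate h (x', canonical_injection x) \<le> ereal \<langle>x, x'\<rangle>"
    show "(x, x') \<in> contact"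
    proof (rule contact_maximal)
      fix y y' assume "(y, y') \<in> contact"
      then have "ereal (\<langle>y, x'\<rangle> + \<langle>x, y'\<rangle> - \<langle>x, x'\<rangle>) \<le> ereal \<langle>y, y'\<rangle>"
        using le[unfolded conjugate_le_iff, rule_format, of y y'] by (simp add: contact_def)
      then show "0 \<le> \<langle>x - y, x' - y'\<rangle>" by (simp add: blinfun.bilinear_simps)
    qed
  qed
  moreover have "conjugate h (x', canonical_injection x) \<ge> ereal \<langle>x, x'\<rangle>" for x x'
    using conjugate_ge[where x' = x' and x'' = "canonical_injection x"] by simp
  ultimately show ?thesis by (auto intro: antisym)
qed

end

section \<open>The Fitzpatrick function of an operator\<close>

lemma fitzpatrick_le_iff:
  "fitzpatrick T (x, x') \<le> c \<longleftrightarrow>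
    (\<forall>(y, y')\<in>T. ereal (\<langle>x, y'\<rangle> + \<langle>y, x'\<rangle> - \<langle>y, y'\<rangle>) \<le> c)"
  by (auto simp: fitzpatrick_def SUP_le_iff)

text \<open>Each term of the supremum equals \<open><x, x'> - <x - y, x' - y'>\<close>.\<close>

lemma fitzpatrick_le_enlargement:
  "fitzpatrick T (x, x') \<le> ereal (\<langle>x, x'\<rangle> + \<epsilon>) \<longleftrightarrow> (x, x') \<in> enlargement \<epsilon> T"
  by (fastforce simp: fitzpatrick_le_iff enlargement_def blinfun.bilinear_simps)

text \<open>The epigraph of a supremum of affine functions is an intersection of
  half-spaces.\<close>

lemma convex_fitzpatrick: "convex_ereal (fitzpatrick T)"
proof -
  have "{(z, r). fitzpatrick T z \<le> ereal r} =
      (\<Inter>(y, y')\<in>T. {(z, r). \<langle>fst z, y'\<rangle> + \<langle>y, snd z\<rangle> - r \<le> \<langle>y, y'\<rangle>})"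
    by (fastforce simp: fitzpatrick_le_iff)
  moreover have "convex {(z, r). \<langle>fst z, y'\<rangle> + \<langle>y, snd z\<rangle> - r \<le> \<langle>y, y'\<rangle>}"
    for y :: 'a and y' :: "'a dual"
  proof -
    have "linear (\<lambda>(z :: 'a \<times> 'a dual, r). \<langle>fst z, y'\<rangle> + \<langle>y, snd z\<rangle> - r)"
      by (rule linearI) (auto simp: blinfun.bilinear_simps algebra_simps)
    then have "convex ((\<lambda>(z :: 'a \<times> 'a dual, r). \<langle>fst z, y'\<rangle> + \<langle>y, snd z\<rangle> - r) -` {.. \<langle>y, y'\<rangle>})"
      by (rule convex_linear_vimage) simp
    moreover have "(\<lambda>(z :: 'a \<times> 'a dual, r). \<langle>fst z, y'\<rangle> + \<langle>y, snd z\<rangle> - r) -` {.. \<langle>y, y'\<rangle>}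
        = {(z, r). \<langle>fst z, y'\<rangle> + \<langle>y, snd z\<rangle> - r \<le> \<langle>y, y'\<rangle>}" by auto
    ultimately show ?thesis by simp
  qed
  ultimately show ?thesis
    unfolding convex_ereal_def by (auto intro!: convex_INT)
qed

text \<open>One affine term exceeding \<open>c\<close> at \<open>z\<close> still does so nearby, and
  the supremum dominates it.\<close>

lemma lower_semicontinuous_fitzpatrick: "lower_semicontinuous (fitzpatrick T)"
  unfolding lower_semicontinuous_def le_Liminf_iff
proof (intro allI impI)
  fix z c assume "c < fitzpatrick T z"
  then obtain y y' where y: "(y, y') \<in> T" "c < ereal (\<langle>fst z, y'\<rangle> + \<langle>y, snd z\<rangle> - \<langle>y, y'\<rangle>)"
    by (cases z) (auto simp: fitzpatrick_def less_SUP_iff)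
  have "((\<lambda>w. ereal (\<langle>fst w, y'\<rangle> + \<langle>y, snd w\<rangle> - \<langle>y, y'\<rangle>))
      \<longlongrightarrow> ereal (\<langle>fst z, y'\<rangle> + \<langle>y, snd z\<rangle> - \<langle>y, y'\<rangle>)) (at z)"
    by (intro tendsto_intros)
  then have "\<forall>\<^sub>F w in at z. c < ereal (\<langle>fst w, y'\<rangle> + \<langle>y, snd w\<rangle> - \<langle>y, y'\<rangle>)"
    using y(2) by (rule order_tendstoD(1))
  then show "\<forall>\<^sub>F w in at z. c < fitzpatrick T w"
  proof eventually_elim
    case (elim w)
    have "ereal (\<langle>fst w, y'\<rangle> + \<langle>y, snd w\<rangle> - \<langle>y, y'\<rangle>) \<le> fitzpatrick T w"
      using fitzpatrick_le_iff[of T "fst w" "snd w" "fitzpatrick T w"] y(1) by auto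
    with elim show ?case by (rule less_le_trans)
  qed
qed

section \<open>The Fitzpatrick function of the contact set\<close>

context monotone_representation
begin

lemma enlargement_0_contact: "enlargement 0 contact \<subseteq> contact"
  by (auto simp: enlargement_def intro!: contact_maximal)

text \<open>A point with a smaller value would lie in the enlargement for 0, hence in
  \<open>contact\<close>; but then its own term in the supremum is \<open><x, x'>\<close>.\<close>

lemma fitzpatrick_contact_ge: "ereal \<langle>x, x'\<rangle> \<le> fitzpatrick contact (x, x')"
proof (rule ccontr)
  assume less: "\<not> ?thesis"
  then have "(x, x') \<in> contact"
    using fitzpatrick_le_enlargement[of contact x x' 0] enlargement_0_contact by auto
  then have "ereal (\<langle>x, x'\<rangle> + \<langle>x, x'\<rangle> - \<langle>x, x'\<rangle>) \<le> fitzpatrick contact (x, x')"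
    using fitzpatrick_le_iff[of contact x x' "fitzpatrick contact (x, x')"] by blast
  with less show False by simp
qed

lemma fitzpatrick_contact_le: "fitzpatrick contact (x, x') \<le> h (x, x')"
  unfolding fitzpatrick_le_iff using contact_tangent[of _ _ x x'] by (auto simp: add.commute)

text \<open>Conjugation reverses \<open>fitzpatrick_contact_le\<close>.\<close>

lemma conjugate_fitzpatrick_contact_ge:
  "ereal \<langle>x', x''\<rangle> \<le> conjugate (fitzpatrick contact) (x', x'')"
proof -
  have "conjugate h (x', x'') \<le> conjugate (fitzpatrick contact) (x', x'')"
    unfolding conjugate_def using fitzpatrick_contact_le
    by (auto intro!: SUP_mono' ereal_minus_mono)
  with conjugate_ge show ?thesis by (rule order_trans)
qed

text \<open>Opens the whole locale to the Fitzpatrick function, which is finite wherever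
  \<open>h\<close> is, being squeezed between the pairing and \<open>h\<close>.\<close>

lemma fitzpatrick_representation: "monotone_representation (fitzpatrick contact)"
proof
  show "proper (fitzpatrick contact)"
    unfolding proper_def
  proof
    have lower: "- \<infinity> < fitzpatrick contact z" for z
      using fitzpatrick_contact_ge[where x = "fst z" and x' = "snd z"]
      by (auto intro: less_le_trans[of _ "ereal _"])
    then show "\<forall>z. - \<infinity> < fitzpatrick contact z" by blast
    obtain z where "\<bar>h z\<bar> \<noteq> \<infinity>" using proper unfolding proper_def by metis
    then have "\<bar>fitzpatrick contact z\<bar> \<noteq> \<infinity>"
      using lower[of z] fitzpatrick_contact_le[of "fst z" "snd z"]
      by (cases "h z"; cases "fitzpatrick contact z") auto
    then show "\<exists>z. \<bar>fitzpatrick contact z\<bar> \<noteq> \<infinity>" by (rule exI)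
  qed
qed (rule convex_fitzpatrick lower_semicontinuous_fitzpatrick fitzpatrick_contact_ge
    conjugate_fitzpatrick_contact_ge)+

text \<open>Membership in the enlargement bounds the gap of the Fitzpatrick function rather than
  that of \<open>h\<close>, so \<open>bronsted_rockafellar\<close> is applied to the former.\<close>

lemma strict_bronsted_rockafellar_contact: "strict_bronsted_rockafellar contact"
  unfolding strict_bronsted_rockafellar_def
proof (intro allI impI)
  fix \<epsilon> \<eta> r :: real and x x'
  assume less: "\<epsilon> < \<eta>" and enl: "(x, x') \<in> enlargement \<epsilon> contact" and r: "0 < r"
  interpret \<phi>: monotone_representation "fitzpatrick contact" by (rule fitzpatrick_representation)
  have le: "fitzpatrick contact (x, x') \<le> ereal (\<langle>x, x'\<rangle> + \<epsilon>)"
    using enl by (simp add: fitzpatrick_le_enlargement)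
  have "ereal \<langle>x, x'\<rangle> \<le> ereal (\<langle>x, x'\<rangle> + \<epsilon>)"
    using fitzpatrick_contact_ge le by (rule order_trans)
  then have "0 \<le> \<epsilon>" by simp
  \<comment> \<open>The midpoint keeps \<open>\<alpha>\<close> positive even for
    \<open>\<epsilon> = 0\<close>, and strictly below \<open>sqrt \<eta>\<close>.\<close>
  define \<alpha> where "\<alpha> = sqrt ((\<epsilon> + \<eta>) / 2)"
  have \<alpha>: "0 < \<alpha>" "\<alpha> < sqrt \<eta>" "\<alpha>\<^sup>2 = (\<epsilon> + \<eta>) / 2"
    using \<open>0 \<le> \<epsilon>\<close> less by (simp_all add: \<alpha>_def)
  have \<eta>: "0 < \<eta>" using \<open>0 \<le> \<epsilon>\<close> less by simp
  have "fitzpatrick contact (x, x') \<le> ereal (\<langle>x, x'\<rangle> + \<alpha>\<^sup>2)"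
    using less by (intro order_trans[OF le]) (simp add: \<alpha>)
  \<comment> \<open>The scale \<open>r / sqrt \<eta>\<close> turns the common bound
    \<open>sqrt \<eta>\<close> into \<open>r\<close> and \<open>\<eta> / r\<close>.\<close>
  then obtain y y' where y: "(y, y') \<in> \<phi>.contact"
    "norm (x - y) / (r / sqrt \<eta>) < sqrt \<eta>" "r / sqrt \<eta> * norm (x' - y') < sqrt \<eta>"
    using \<phi>.bronsted_rockafellar[of x x' \<alpha> "sqrt \<eta>" "r / sqrt \<eta>"] \<alpha> \<eta> r by auto
  \<comment> \<open>Contact points of the Fitzpatrick function lie in the enlargement for 0, hence
    in \<open>contact\<close>.\<close>
  have "(y, y') \<in> contact"
    using y(1) fitzpatrick_le_enlargement[of contact y y' 0] enlargement_0_contact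
    by (auto simp: \<phi>.contact_def)
  moreover have "norm (x - y) < r" using y(2) r \<eta> by (simp add: field_simps)
  moreover have "norm (x' - y') < \<eta> / r" using y(3) r \<eta> by (simp add: field_simps)
  ultimately show "\<exists>(y, y')\<in>contact. norm (x - y) < r \<and> norm (x' - y') < \<eta> / r" by blast
qed

end

theorem theorem4p2:
  fixes h :: "'a::banach \<times> 'a dual \<Rightarrow> ereal"
    and T :: "('a \<times> 'a dual) set"
  assumes "proper h"
    and "convex_ereal h"
    and "lower_semicontinuous h"
    and "\<And>x x'. h (x, x') \<ge> ereal \<langle>x, x'\<rangle>"
    and "\<And>x' x''. conjugate h (x', x'') \<ge> ereal \<langle>x', x''\<rangle>"
    and "T = {(x, x'). h (x, x') = ereal \<langle>x, x'\<rangle>}"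
  shows "T = {(x, x'). conjugate h (x', canonical_injection x) = ereal \<langle>x, x'\<rangle>} \<and>
    maximal_monotone T \<and>
    (\<forall>x x'. fitzpatrick T (x, x') \<ge> ereal \<langle>x, x'\<rangle>) \<and>
    (\<forall>x' x''. conjugate (fitzpatrick T) (x', x'') \<ge> ereal \<langle>x', x''\<rangle>) \<and>
    strict_bronsted_rockafellar T"
proof -
  interpret monotone_representation h using assms(1-5) by unfold_locales
  have "T = contact" using assms(6) by (simp add: contact_def)
  then show ?thesis
    using contact_eq_conjugate maximal_monotone_contact fitzpatrick_contact_ge
      conjugate_fitzpatrick_contact_ge strict_bronsted_rockafellar_contact by simp
qed

end
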